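(* Let $G$ be a group and $K$ a division ring. Every representation $\rho:G\to SGL(V)$ of $G$ over $K$ on a $K$-module $V$ with $\operatorname{rank}(V)\ge 3$ determines a $G$-lattice over $K$: the lattice $L(V)$ is a $G$-lattice under $gW=\rho(g)W=\{\rho(g)w\mid w\in W\}$ for $g\in G$, $W\in L(V)$. Conversely, given a $G$-lattice $L=L(V)$ over $K$ (with $V$ a $K$-module of rank at least $3$), there is a representation $\rho:G\to SGL(V)$ of $G$ over $K$ that determines $L$, i.e. such that $gW=\rho(g)W$ for all $g\in G$ and $W\in L(V)$.
   Context: Modules are left modules over the division ring $K$; $K^*=K\setminus\{0\}$. A semilinear transformation of $V$ is an additive map $f:V\to V$ for which there is a ring automorphism $\theta_f$ of $K$ with $f(\alpha v)=\theta_f(\alpha)f(v)$ for all $\alpha\in K$, $v\in V$. $SGL(V)$ is the group (under composition) of bijective semilinear transformations of $V$. A representation of $G$ over $K$ means a semilinear projective representation: a map $\rho:G\to SGL(V)$, $V$ a $K$-module, such that for all $g,h\in G$ there is $\alpha(g,h)\in K^*$ with $\rho(g)\rho(h)=\alpha(g,h)\rho(gh)$; here $(\alpha f)(v)=\alpha\, f(v)$. A $G$-lattice is a lattice $L$ with a map $G\times L\to L$, $(g,m)\mapsto gm$, such that for all $g,h\in G$, $m,n\in L$: $g(hm)=(gh)m$; $em=m$ for the identity $e$; $m\le n$ iff $gm\le gn$; $g(m\wedge n)=gm\wedge gn$; $g(m\vee n)=gm\vee gn$. $L(V)$ is the lattice of all submodules of $V$. A $G$-lattice over $K$ is a $G$-lattice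 whose underlying lattice is $L(V)$ for a $K$-module $V$ with $\operatorname{rank}(V)\ge 3$ (the module $V$ is part of the data). Standing assumption: all lattice morphisms $f:L(V)\to L(V)$ considered (with $\operatorname{rank}(V)\ge3$) are coordinatizable, i.e. there is a semilinear transformation $f':V\to V$ with $f(W)=\{f'(w)\mid w\in W\}$ for all $W\in L(V)$. *)

theory Defs
  imports Complex_Main "HOL-Library.Extended_Nat" "HOL-Algebra.Group" "HOL-Algebra.Lattice"
begin

section \<open>Left modules over a division ring\<close>

text \<open>The library locales \<open>module\<close> and \<open>vector_space\<close> require commutative scalars, so the
  basic notions are set up here for a not necessarily commutative division ring of scalars.\<close>

locale left_module =
  fixes scale :: "'k::division_ring \<Rightarrow> 'v::ab_group_add \<Rightarrow> 'v"
  assumes scale_right_distrib: "scale a (x + y) = scale a x + scale a y"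
    and scale_left_distrib: "scale (a + b) x = scale a x + scale b x"
    and scale_scale: "scale a (scale b x) = scale (a * b) x"
    and scale_one: "scale 1 x = x"

definition submodule :: "('k::division_ring \<Rightarrow> 'v::ab_group_add \<Rightarrow> 'v) \<Rightarrow> 'v set \<Rightarrow> bool" where
  "submodule scale W \<longleftrightarrow>
     0 \<in> W \<and> (\<forall>x\<in>W. \<forall>y\<in>W. x + y \<in> W) \<and> (\<forall>a. \<forall>x\<in>W. scale a x \<in> W)"

definition lin_indep :: "('k::division_ring \<Rightarrow> 'v::ab_group_add \<Rightarrow> 'v) \<Rightarrow> 'v set \<Rightarrow> bool" where
  "lin_indep scale B \<longleftrightarrow>
     (\<forall>F c. finite F \<and> F \<subseteq> B \<and> (\<Sum>b\<in>F. scale (c b) b) = 0 \<longrightarrow> (\<forall>b\<in>F. c b = 0))"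

definition is_basis :: "('k::division_ring \<Rightarrow> 'v::ab_group_add \<Rightarrow> 'v) \<Rightarrow> 'v set \<Rightarrow> bool" where
  "is_basis scale B \<longleftrightarrow> lin_indep scale B \<and> submodule scale hull B = UNIV"

text \<open>The number of elements of a basis, with all infinite cardinalities identified with \<open>\<infinity>\<close>.
  Modules over a division ring have bases, any two of the same cardinality, so the choice of the
  basis is immaterial and the \<open>else\<close> branch is never taken for a \<open>left_module\<close>; it follows the
  pattern of \<open>vector_space.dim\<close>.\<close>

definition rank :: "('k::division_ring \<Rightarrow> 'v::ab_group_add \<Rightarrow> 'v) \<Rightarrow> enat" where
  "rank scale =
     (if \<exists>B. is_basis scale B
      then (let B = (SOME B. is_basis scale B) in if finite B then enat (card B) else \<infinity>)
      else 0)"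

definition submodule_lattice :: "('k::division_ring \<Rightarrow> 'v::ab_group_add \<Rightarrow> 'v) \<Rightarrow> 'v set gorder" where
  "submodule_lattice scale = \<lparr>carrier = {W. submodule scale W}, eq = (=), le = (\<subseteq>)\<rparr>"


section \<open>Semilinear transformations and semilinear projective representations\<close>

definition ring_automorphism :: "('k::division_ring \<Rightarrow> 'k) \<Rightarrow> bool" where
  "ring_automorphism \<theta> \<longleftrightarrow>
     bij \<theta> \<and> (\<forall>a b. \<theta> (a + b) = \<theta> a + \<theta> b) \<and> (\<forall>a b. \<theta> (a * b) = \<theta> a * \<theta> b) \<and> \<theta> 1 = 1"

definition semilinear ::
  "('k::division_ring \<Rightarrow> 'v::ab_group_add \<Rightarrow> 'v) \<Rightarrow> ('v \<Rightarrow> 'v) \<Rightarrow> bool" where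
  "semilinear scale f \<longleftrightarrow>
     additive f \<and> (\<exists>\<theta>. ring_automorphism \<theta> \<and> (\<forall>a v. f (scale a v) = scale (\<theta> a) (f v)))"

definition SGL :: "('k::division_ring \<Rightarrow> 'v::ab_group_add \<Rightarrow> 'v) \<Rightarrow> ('v \<Rightarrow> 'v) monoid" where
  "SGL scale = \<lparr>carrier = {f. bij f \<and> semilinear scale f}, mult = (\<circ>), one = id\<rparr>"

lemma ring_automorphism_comp:
  "ring_automorphism s \<Longrightarrow> ring_automorphism t \<Longrightarrow> ring_automorphism (s \<circ> t)"
  unfolding ring_automorphism_def by (auto intro: bij_comp)

lemma ring_automorphism_inv:
  assumes "ring_automorphism s" shows "ring_automorphism (inv_into UNIV s)"
proof -
  have s: "bij s" "\<And>a b. s (a + b) = s a + s b" "\<And>a b. s (a * b) = s a * s b" "s 1 = 1"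
    using assms by (auto simp: ring_automorphism_def)
  have i: "\<And>x. s (inv_into UNIV s x) = x" using s(1) by (simp add: bij_is_surj surj_f_inv_f)
  have j: "\<And>x y. s x = y \<Longrightarrow> inv_into UNIV s y = x" using s(1) by (auto simp: bij_is_inj)
  show ?thesis unfolding ring_automorphism_def
    using s i by (auto intro!: j simp: bij_imp_bij_inv)
qed

lemma group_SGL: "group (SGL scale)"
proof (rule groupI)
  show "\<one>\<^bsub>SGL scale\<^esub> \<in> carrier (SGL scale)"
    by (auto simp: SGL_def semilinear_def ring_automorphism_def additive_def intro!: exI[of _ id])
next
  fix f h assume "f \<in> carrier (SGL scale)" "h \<in> carrier (SGL scale)"
  then obtain s t where f: "bij f" "additive f" "ring_automorphism s"
      "\<And>a v. f (scale a v) = scale (s a) (f v)"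
    and h: "bij h" "additive h" "ring_automorphism t" "\<And>a v. h (scale a v) = scale (t a) (h v)"
    by (auto simp: SGL_def semilinear_def)
  have "semilinear scale (f \<circ> h)"
    unfolding semilinear_def
    using f h ring_automorphism_comp[OF f(3) h(3)]
    by (auto simp: additive_def intro!: exI[of _ "s \<circ> t"])
  then show "f \<otimes>\<^bsub>SGL scale\<^esub> h \<in> carrier (SGL scale)"
    using f h by (auto simp: SGL_def bij_comp)
next
  fix f assume "f \<in> carrier (SGL scale)"
  then obtain s where f: "bij f" "additive f" "ring_automorphism s"
      "\<And>a v. f (scale a v) = scale (s a) (f v)"
    by (auto simp: SGL_def semilinear_def)
  have fi: "\<And>x. f (inv_into UNIV f x) = x" using f(1) by (simp add: bij_is_surj surj_f_inv_f)
  have fj: "\<And>x y. f x = y \<Longrightarrow> inv_into UNIV f y = x" using f(1) by (auto simp: bij_is_inj)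
  have si: "\<And>x. s (inv_into UNIV s x) = x"
    using f(3) by (simp add: ring_automorphism_def bij_is_surj surj_f_inv_f)
  have "additive (inv_into UNIV f)"
    using f(2) fi by (auto simp: additive_def intro!: fj)
  moreover have "\<And>a v. inv_into UNIV f (scale a v) = scale (inv_into UNIV s a) (inv_into UNIV f v)"
    by (rule fj) (simp add: f(4) fi si)
  ultimately have "semilinear scale (inv_into UNIV f)"
    unfolding semilinear_def using ring_automorphism_inv[OF f(3)] by blast
  then show "\<exists>h\<in>carrier (SGL scale). h \<otimes>\<^bsub>SGL scale\<^esub> f = \<one>\<^bsub>SGL scale\<^esub>"
    using f(1) by (intro bexI[of _ "inv_into UNIV f"])
      (auto simp: SGL_def bij_imp_bij_inv bij_is_inj)
qed (auto simp: SGL_def)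

definition semilinear_representation ::
  "('g, 'm) monoid_scheme \<Rightarrow> ('k::division_ring \<Rightarrow> 'v::ab_group_add \<Rightarrow> 'v) \<Rightarrow> ('g \<Rightarrow> 'v \<Rightarrow> 'v) \<Rightarrow> bool" where
  "semilinear_representation G scale \<rho> \<longleftrightarrow>
     \<rho> \<in> carrier G \<rightarrow> carrier (SGL scale) \<and>
     (\<forall>g\<in>carrier G. \<forall>h\<in>carrier G. \<exists>\<alpha>. \<alpha> \<noteq> 0 \<and>
        \<rho> g \<otimes>\<^bsub>SGL scale\<^esub> \<rho> h = (\<lambda>v. scale \<alpha> (\<rho> (g \<otimes>\<^bsub>G\<^esub> h) v)))"


section \<open>Lattices with a group action\<close>

locale G_lattice = group G + lattice L
  for G :: "('g, 'm) monoid_scheme" and L :: "('l, 'n) gorder_scheme" +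
  fixes act :: "'g \<Rightarrow> 'l \<Rightarrow> 'l"
  assumes act_closed: "\<lbrakk>g \<in> carrier G; m \<in> carrier L\<rbrakk> \<Longrightarrow> act g m \<in> carrier L"
    and act_act: "\<lbrakk>g \<in> carrier G; h \<in> carrier G; m \<in> carrier L\<rbrakk> \<Longrightarrow>
      act g (act h m) = act (g \<otimes>\<^bsub>G\<^esub> h) m"
    and act_one: "m \<in> carrier L \<Longrightarrow> act \<one>\<^bsub>G\<^esub> m = m"
    and act_le_iff: "\<lbrakk>g \<in> carrier G; m \<in> carrier L; n \<in> carrier L\<rbrakk> \<Longrightarrow>
      m \<sqsubseteq>\<^bsub>L\<^esub> n \<longleftrightarrow> act g m \<sqsubseteq>\<^bsub>L\<^esub> act g n"
    and act_meet: "\<lbrakk>g \<in> carrier G; m \<in> carrier L; n \<in> carrier L\<rbrakk> \<Longrightarrow>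
      act g (m \<sqinter>\<^bsub>L\<^esub> n) = act g m \<sqinter>\<^bsub>L\<^esub> act g n"
    and act_join: "\<lbrakk>g \<in> carrier G; m \<in> carrier L; n \<in> carrier L\<rbrakk> \<Longrightarrow>
      act g (m \<squnion>\<^bsub>L\<^esub> n) = act g m \<squnion>\<^bsub>L\<^esub> act g n"

definition G_lattice_over ::
  "('g, 'm) monoid_scheme \<Rightarrow> ('k::division_ring \<Rightarrow> 'v::ab_group_add \<Rightarrow> 'v) \<Rightarrow>
    ('g \<Rightarrow> 'v set \<Rightarrow> 'v set) \<Rightarrow> bool" where
  "G_lattice_over G scale act \<longleftrightarrow>
     left_module scale \<and> 3 \<le> rank scale \<and> G_lattice G (submodule_lattice scale) act"

text \<open>To be required of the maps \<open>W \<mapsto> gW\<close> only: it fails for arbitrary maps preserving meets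
  and joins, for instance the constant map with value \<open>V\<close> if \<open>V\<close> is nonzero.\<close>

definition coordinatizable ::
  "('k::division_ring \<Rightarrow> 'v::ab_group_add \<Rightarrow> 'v) \<Rightarrow> ('v set \<Rightarrow> 'v set) \<Rightarrow> bool" where
  "coordinatizable scale f \<longleftrightarrow>
     (\<exists>f'. semilinear scale f' \<and> (\<forall>W\<in>carrier (submodule_lattice scale). f W = f' ` W))"

end

theory Submission
  imports Defs
begin

text \<open>A scalar \<open>\<alpha> \<noteq> 0\<close> maps every submodule onto itself. So in passing from semilinear bijections to
  the permutations of the submodule lattice that they induce, the factors \<open>\<alpha>(g, h)\<close> of a projective
  representation disappear and a genuine action remains, see
  \<open>semilinear_representation_imp_G_lattice_over\<close>. It acts by monotone maps, which have
  monotone inverses because \<open>G\<close> is a group; hence meets and joins are preserved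
  (\<open>G_lattice_of_monotone_action\<close>).

  For the converse one chooses, for each \<open>g\<close>, a semilinear map \<open>\<rho> g\<close> inducing \<open>W \<mapsto> gW\<close>. Since
  the latter is a permutation of the lattice, \<open>\<rho> g\<close> kills no line and has full image, so it is
  bijective. The maps \<open>\<rho> g \<circ> \<rho> h\<close> and \<open>\<rho> (gh)\<close> then induce the same permutation of the lattice,
  and what remains is that such maps agree up to a scalar. This is the fact that an additive map
  sending every vector into its own line is a homothety once there are two independent vectors
  (\<open>line_preserving_imp_homothety\<close>), applied to \<open>(\<rho> g \<circ> \<rho> h) \<circ> (\<rho> (gh))\<inverse>\<close>; the assumption on the
  rank supplies the two vectors.\<close>

section \<open>The lattice of submodules\<close>

context left_module
begin

lemma scale_zero_left: "scale 0 x = 0"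
  using scale_left_distrib[of 0 0 x] by simp

lemma scale_zero_right: "scale a 0 = 0"
  using scale_right_distrib[of a 0 0] by simp

lemma scale_minus_left: "scale (- a) x = - scale a x"
  using scale_left_distrib[of "- a" a x] by (simp add: scale_zero_left eq_neg_iff_add_eq_0)

lemma scale_diff_left: "scale (a - b) x = scale a x - scale b x"
  using scale_left_distrib[of a "- b" x] by (simp add: scale_minus_left)

lemma scale_inverse_cancel: "a \<noteq> 0 \<Longrightarrow> scale (inverse a) (scale a x) = x"
  by (simp add: scale_scale scale_one)

lemma scale_cancel_inverse: "a \<noteq> 0 \<Longrightarrow> scale a (scale (inverse a) x) = x"
  by (simp add: scale_scale scale_one)

lemma scale_eq_0D: "scale a x = 0 \<Longrightarrow> a = 0 \<or> x = 0"
  by (metis scale_inverse_cancel scale_zero_right)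

lemma submodule_line: "submodule scale (range (\<lambda>a. scale a x))"
  unfolding submodule_def
  by (auto simp: scale_scale scale_left_distrib[symmetric]
      intro: range_eqI[of _ _ 0] simp: scale_zero_left)

lemma in_line: "x \<in> range (\<lambda>a. scale a x)"
  by (rule range_eqI[of _ _ 1]) (simp add: scale_one)

lemma submodule_zero: "submodule scale {0}"
  by (simp add: submodule_def scale_zero_right)

lemma submodule_UNIV: "submodule scale UNIV"
  by (simp add: submodule_def)

lemma scale_image_submodule:
  assumes "submodule scale W" and "a \<noteq> 0"
  shows "scale a ` W = W"
proof
  show "scale a ` W \<subseteq> W" using assms(1) by (auto simp: submodule_def)
  show "W \<subseteq> scale a ` W"
  proof
    fix x assume "x \<in> W"
    then have "scale (inverse a) x \<in> W" using assms(1) by (simp add: submodule_def)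
    then show "x \<in> scale a ` W"
      using scale_cancel_inverse[OF assms(2), of x] by (metis image_eqI)
  qed
qed

end

lemma submodule_Inter: "(\<And>W. W \<in> S \<Longrightarrow> submodule scale W) \<Longrightarrow> submodule scale (\<Inter> S)"
  by (auto simp: submodule_def)

lemma carrier_submodule_lattice [simp]:
  "W \<in> carrier (submodule_lattice scale) \<longleftrightarrow> submodule scale W"
  by (simp add: submodule_lattice_def)

lemma le_submodule_lattice [simp]: "le (submodule_lattice scale) = (\<subseteq>)"
  by (simp add: submodule_lattice_def)

lemma lattice_submodule_lattice: "lattice (submodule_lattice scale)"
proof -
  let ?L = "submodule_lattice scale"
  interpret partial_order ?L
    by unfold_locales (auto simp: submodule_lattice_def)
  show ?thesis
  proof unfold_locales
    fix W X assume WX: "W \<in> carrier ?L" "X \<in> carrier ?L"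
    have "submodule scale (submodule scale hull (W \<union> X))"
      unfolding hull_def by (rule submodule_Inter) simp
    moreover have "submodule scale hull (W \<union> X) \<subseteq> Y"
      if "submodule scale Y" "W \<subseteq> Y" "X \<subseteq> Y" for Y
      using that by (simp add: hull_minimal)
    ultimately have "least ?L (submodule scale hull (W \<union> X)) (Upper ?L {W, X})"
      using WX hull_subset[of "W \<union> X" "submodule scale"]
      by (intro least_UpperI) (auto simp: Upper_def)
    then show "\<exists>s. least ?L s (Upper ?L {W, X})" ..
  next
    fix W X assume WX: "W \<in> carrier ?L" "X \<in> carrier ?L"
    then have "submodule scale (W \<inter> X)"
      using submodule_Inter[of "{W, X}" scale] by auto
    then have "greatest ?L (W \<inter> X) (Lower ?L {W, X})"
      using WX by (intro greatest_LowerI) (auto simp: Lower_def)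
    then show "\<exists>i. greatest ?L i (Lower ?L {W, X})" ..
  qed
qed


section \<open>Monotone actions on a lattice\<close>

text \<open>Each \<open>act g\<close> has the monotone inverse \<open>act (inv g)\<close>, and an order isomorphism preserves
  every meet and join that exists.\<close>

lemma G_lattice_of_monotone_action:
  fixes G (structure) and L :: "('l, 'n) gorder_scheme"
  assumes "group G" and "lattice L"
    and closed: "\<And>g m. \<lbrakk>g \<in> carrier G; m \<in> carrier L\<rbrakk> \<Longrightarrow> act g m \<in> carrier L"
    and comp: "\<And>g h m. \<lbrakk>g \<in> carrier G; h \<in> carrier G; m \<in> carrier L\<rbrakk> \<Longrightarrow>
      act g (act h m) = act (g \<otimes> h) m"
    and one: "\<And>m. m \<in> carrier L \<Longrightarrow> act \<one> m = m"
    and mono: "\<And>g m n. \<lbrakk>g \<in> carrier G; m \<in> carrier L; n \<in> carrier L; m \<sqsubseteq>\<^bsub>L\<^esub> n\<rbrakk> \<Longrightarrow>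
      act g m \<sqsubseteq>\<^bsub>L\<^esub> act g n"
  shows "G_lattice G L act"
proof -
  interpret group G by fact
  interpret L: lattice L by fact
  have inv_act: "act (inv g) (act g m) = m" and act_inv: "act g (act (inv g) m) = m"
    if "g \<in> carrier G" "m \<in> carrier L" for g m
    using that by (simp_all add: comp one)
  show ?thesis
  proof unfold_locales
    fix g m n assume g: "g \<in> carrier G" and mn: "m \<in> carrier L" "n \<in> carrier L"
    note closed' = closed[OF g] closed[OF inv_closed[OF g]]
    show "m \<sqsubseteq>\<^bsub>L\<^esub> n \<longleftrightarrow> act g m \<sqsubseteq>\<^bsub>L\<^esub> act g n"
      using mono[of g m n] mono[of "inv g" "act g m" "act g n"] g mn
      by (auto simp: inv_act closed)
    show "act g (m \<sqinter>\<^bsub>L\<^esub> n) = act g m \<sqinter>\<^bsub>L\<^esub> act g n"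
    proof (rule L.le_antisym)
      show "act g (m \<sqinter>\<^bsub>L\<^esub> n) \<sqsubseteq>\<^bsub>L\<^esub> act g m \<sqinter>\<^bsub>L\<^esub> act g n"
        using g mn by (intro L.meet_le mono closed L.meet_left L.meet_right L.meet_closed)
      let ?k = "act g m \<sqinter>\<^bsub>L\<^esub> act g n"
      have k: "?k \<in> carrier L" using g mn by (simp add: closed)
      have "act (inv g) ?k \<sqsubseteq>\<^bsub>L\<^esub> act (inv g) (act g m)" "act (inv g) ?k \<sqsubseteq>\<^bsub>L\<^esub> act (inv g) (act g n)"
        using g mn by (intro mono L.meet_left L.meet_right L.meet_closed closed inv_closed; simp)+
      then have "act (inv g) ?k \<sqsubseteq>\<^bsub>L\<^esub> m \<sqinter>\<^bsub>L\<^esub> n"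
        using mn k closed' by (intro L.meet_le) (simp_all add: inv_act[OF g])
      then have "act g (act (inv g) ?k) \<sqsubseteq>\<^bsub>L\<^esub> act g (m \<sqinter>\<^bsub>L\<^esub> n)"
        using g mn k closed' by (intro mono) simp_all
      then show "?k \<sqsubseteq>\<^bsub>L\<^esub> act g (m \<sqinter>\<^bsub>L\<^esub> n)" using act_inv[OF g k] by simp
    qed (use g mn closed in simp_all)
    show "act g (m \<squnion>\<^bsub>L\<^esub> n) = act g m \<squnion>\<^bsub>L\<^esub> act g n"
    proof (rule L.le_antisym)
      show "act g m \<squnion>\<^bsub>L\<^esub> act g n \<sqsubseteq>\<^bsub>L\<^esub> act g (m \<squnion>\<^bsub>L\<^esub> n)"
        using g mn by (intro L.join_le mono closed L.join_left L.join_right L.join_closed)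
      let ?k = "act g m \<squnion>\<^bsub>L\<^esub> act g n"
      have k: "?k \<in> carrier L" using g mn by (simp add: closed)
      have "act (inv g) (act g m) \<sqsubseteq>\<^bsub>L\<^esub> act (inv g) ?k" "act (inv g) (act g n) \<sqsubseteq>\<^bsub>L\<^esub> act (inv g) ?k"
        using g mn by (intro mono L.join_left L.join_right L.join_closed closed inv_closed; simp)+
      then have "m \<squnion>\<^bsub>L\<^esub> n \<sqsubseteq>\<^bsub>L\<^esub> act (inv g) ?k"
        using mn k closed' by (intro L.join_le) (simp_all add: inv_act[OF g])
      then have "act g (m \<squnion>\<^bsub>L\<^esub> n) \<sqsubseteq>\<^bsub>L\<^esub> act g (act (inv g) ?k)"
        using g mn k closed' by (intro mono) simp_all
      then show "act g (m \<squnion>\<^bsub>L\<^esub> n) \<sqsubseteq>\<^bsub>L\<^esub> ?k" using act_inv[OF g k] by simp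
    qed (use g mn closed in simp_all)
  qed (simp_all add: closed comp one)
qed


section \<open>From representations to lattice actions\<close>

lemma semilinear_add: "semilinear scale f \<Longrightarrow> f (x + y) = f x + f y"
  by (simp add: semilinear_def additive_def)

lemma semilinear_zero: "semilinear scale f \<Longrightarrow> f 0 = 0"
  by (simp add: semilinear_def additive.zero)

text \<open>Closure of the image under scalars uses that the companion automorphism \<open>\<theta>\<close> is onto:
  \<open>a f(x) = f(\<theta>\<inverse>(a) x)\<close>.\<close>

lemma submodule_semilinear_image:
  assumes f: "semilinear scale f" and W: "submodule scale W"
  shows "submodule scale (f ` W)"
proof -
  obtain \<theta> where \<theta>: "ring_automorphism \<theta>" "\<And>a v. f (scale a v) = scale (\<theta> a) (f v)"
    using f by (auto simp: semilinear_def)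
  have "scale a (f x) \<in> f ` W" if "x \<in> W" for a x
  proof -
    obtain b where "\<theta> b = a" using \<theta>(1) by (metis ring_automorphism_def bij_pointE)
    then have "scale a (f x) = f (scale b x)" by (simp add: \<theta>(2))
    then show ?thesis using W that by (simp add: submodule_def)
  qed
  moreover have "0 \<in> f ` W"
    using W semilinear_zero[OF f] by (metis submodule_def image_eqI)
  moreover have "f x + f y \<in> f ` W" if "x \<in> W" "y \<in> W" for x y
    using W that by (auto simp: submodule_def semilinear_add[OF f, symmetric])
  ultimately show ?thesis by (auto simp: submodule_def)
qed

lemma semilinear_representation_imp_G_lattice_over:
  fixes G (structure)
  assumes "group G" and "left_module scale" and "rank scale \<ge> 3"
    and \<rho>: "semilinear_representation G scale \<rho>"
  shows "G_lattice_over G scale (\<lambda>g W. \<rho> g ` W)"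
proof -
  interpret group G by fact
  interpret left_module scale by fact
  have semi: "semilinear scale (\<rho> g)" and bij: "bij (\<rho> g)" if "g \<in> carrier G" for g
    using \<rho> that by (auto simp: semilinear_representation_def SGL_def)
  have proj: "\<exists>a. a \<noteq> 0 \<and> (\<forall>v. \<rho> g (\<rho> h v) = scale a (\<rho> (g \<otimes> h) v))"
    if "g \<in> carrier G" "h \<in> carrier G" for g h
    using \<rho> that by (auto simp: semilinear_representation_def SGL_def fun_eq_iff)
  have "G_lattice G (submodule_lattice scale) (\<lambda>g W. \<rho> g ` W)"
  proof (rule G_lattice_of_monotone_action)
    fix g h W assume gh: "g \<in> carrier G" "h \<in> carrier G" "W \<in> carrier (submodule_lattice scale)"
    obtain a where a: "a \<noteq> 0" "\<And>v. \<rho> g (\<rho> h v) = scale a (\<rho> (g \<otimes> h) v)"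
      using proj gh by blast
    have "\<rho> g ` \<rho> h ` W = scale a ` \<rho> (g \<otimes> h) ` W"
      by (simp add: image_image a(2))
    then show "\<rho> g ` \<rho> h ` W = \<rho> (g \<otimes> h) ` W"
      using gh a(1) by (simp add: scale_image_submodule submodule_semilinear_image semi)
  next
    fix W assume W: "W \<in> carrier (submodule_lattice scale)"
    obtain a where a: "a \<noteq> 0" "\<And>v. \<rho> \<one> (\<rho> \<one> v) = scale a (\<rho> \<one> v)"
      using proj[of \<one> \<one>] by auto
    \<comment> \<open>\<open>\<rho> \<one>\<close> need not be the identity, but as \<open>\<rho> \<one>\<close> is onto, it is multiplication by \<open>a\<close>.\<close>
    have "\<rho> \<one> v = scale a v" for v
      using a(2) bij[OF one_closed] by (metis bij_pointE)
    then show "\<rho> \<one> ` W = W"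
      using W a(1) scale_image_submodule[of W a] by simp
  qed (auto simp: assms(1) lattice_submodule_lattice submodule_semilinear_image semi)
  then show ?thesis using assms(2,3) by (simp add: G_lattice_over_def)
qed


section \<open>Homotheties\<close>

context left_module
begin

text \<open>Independence, put as: the two lines meet only in zero. Equations between a multiple of \<open>x\<close> and
  a multiple of \<open>y\<close> are the form in which it is used.\<close>

definition independent_pair :: "'v \<Rightarrow> 'v \<Rightarrow> bool" where
  "independent_pair x y \<longleftrightarrow>
     x \<noteq> 0 \<and> y \<noteq> 0 \<and> (\<forall>a b. scale a x = scale b y \<longrightarrow> scale a x = 0)"

lemma rank_ge_3_imp_independent_pair:
  assumes "rank scale \<ge> 3"
  shows "\<exists>x y. independent_pair x y"
proof -
  define B where "B = (SOME B. is_basis scale B)"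
  have ex: "\<exists>B. is_basis scale B"
    using assms by (auto simp: rank_def split: if_splits)
  then have "is_basis scale B" unfolding B_def by (rule someI_ex)
  then have indep: "lin_indep scale B" by (simp add: is_basis_def)
  have "\<not> (finite B \<and> card B < 2)"
    using assms ex by (auto simp: rank_def B_def[symmetric] Let_def numeral_eq_enat)
  then have "\<exists>x y. x \<in> B \<and> y \<in> B \<and> x \<noteq> y"
  proof (cases "finite B")
    case True
    then have "\<not> card B \<le> Suc 0" using \<open>\<not> (finite B \<and> card B < 2)\<close> by simp
    then show ?thesis using True by (auto simp: card_le_Suc0_iff_eq)
  next
    case False
    then obtain x where "x \<in> B" by fastforce
    moreover obtain y where "y \<in> B - {x}"
      using False by (metis finite.emptyI finite_Diff_insert Diff_empty equals0I)
    ultimately show ?thesis by blast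
  qed
  then obtain x y where xy: "x \<in> B" "y \<in> B" "x \<noteq> y" by blast
  have coeff0: "a = 0 \<and> b = 0" if "scale a x + scale b y = 0" for a b
  proof -
    have "(\<Sum>z\<in>{x, y}. scale (if z = x then a else b) z) = 0"
      using xy(3) that by auto
    then have "\<forall>z\<in>{x, y}. (if z = x then a else b) = 0"
      using indep xy(1,2) unfolding lin_indep_def
      by (elim allE[of _ "{x, y}"] allE[of _ "\<lambda>z. if z = x then a else b"]) auto
    then show ?thesis using xy(3) by auto
  qed
  have "x \<noteq> 0" "y \<noteq> 0"
    using coeff0[of 1 0] coeff0[of 0 1] by (auto simp: scale_zero_left scale_zero_right)
  moreover have "scale a x = 0" if "scale a x = scale b y" for a b
    using coeff0[of a "- b"] that by (simp add: scale_minus_left scale_zero_left)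
  ultimately show ?thesis unfolding independent_pair_def by blast
qed

text \<open>Comparing coefficients in \<open>F(x + y) = F(x) + F(y)\<close>: both eigenvalues equal that of \<open>x + y\<close>.\<close>

lemma eigenvalues_eq:
  assumes F: "additive F" "\<And>u. F u = scale (c u) u" and xy: "independent_pair x y"
  shows "c x = c y"
proof -
  have "scale (c (x + y)) x + scale (c (x + y)) y = scale (c x) x + scale (c y) y"
    using F(1) by (simp add: additive_def F(2) scale_right_distrib)
  then have eq: "scale (c (x + y) - c x) x = scale (c y - c (x + y)) y"
    by (simp add: scale_diff_left algebra_simps)
  then have "scale (c (x + y) - c x) x = 0"
    using xy by (simp add: independent_pair_def)
  moreover from this eq have "scale (c y - c (x + y)) y = 0" by simp
  ultimately show ?thesis
    using xy by (auto simp: independent_pair_def dest!: scale_eq_0D)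
qed

text \<open>Given independent \<open>x\<close> and \<open>y\<close>, a nonzero vector cannot lie on both of their lines. So it is
  independent of one of them and shares its eigenvalue.\<close>

lemma line_preserving_imp_homothety:
  assumes F: "additive F" "\<And>u. F u \<in> range (\<lambda>a. scale a u)" and xy: "independent_pair x y"
  shows "\<exists>a. \<forall>u. F u = scale a u"
proof -
  have "\<forall>u. \<exists>a. F u = scale a u" using F(2) by auto
  then obtain c where c: "\<And>u. F u = scale (c u) u" by metis
  note eigen = eigenvalues_eq[OF F(1) c]
  have multiple: "\<exists>d. u = scale d z" if "u \<noteq> 0" "z \<noteq> 0" "\<not> independent_pair u z" for u z
  proof -
    obtain a b where ab: "scale a u = scale b z" "scale a u \<noteq> 0"
      using \<open>u \<noteq> 0\<close> \<open>z \<noteq> 0\<close> \<open>\<not> independent_pair u z\<close> by (auto simp: independent_pair_def)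
    then have "a \<noteq> 0" by (auto simp: scale_zero_left)
    then have "u = scale (inverse a * b) z"
      using ab(1) scale_inverse_cancel[of a u] by (simp add: scale_scale)
    then show ?thesis ..
  qed
  have "F u = scale (c x) u" for u
  proof (cases "u = 0")
    case True
    then show ?thesis by (simp add: c scale_zero_right)
  next
    case False
    have "independent_pair u x \<or> independent_pair u y"
    proof (rule ccontr)
      assume "\<not> ?thesis"
      moreover have "x \<noteq> 0" "y \<noteq> 0" using xy by (simp_all add: independent_pair_def)
      ultimately obtain d e where "u = scale d x" "u = scale e y"
        using multiple[OF False] by metis
      then show False using xy False unfolding independent_pair_def by metis
    qed
    then show ?thesis using eigen xy by (metis c)
  qed
  then show ?thesis by blast
qed

text \<open>If \<open>p\<close> and \<open>q\<close> induce the same lattice map, then \<open>p \<circ> q\<inverse>\<close> preserves every line.\<close>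

lemma same_images_imp_proportional:
  assumes p: "additive p" and q: "additive q" "bij q"
    and same: "\<And>W. submodule scale W \<Longrightarrow> p ` W = q ` W"
    and q_line: "\<And>v. q ` range (\<lambda>a. scale a v) \<subseteq> range (\<lambda>a. scale a (q v))"
    and xy: "independent_pair x y"
  shows "\<exists>a. \<forall>v. p v = scale a (q v)"
proof -
  define F where "F = p \<circ> inv_into UNIV q"
  have Fq: "F (q v) = p v" for v
    using q(2) by (simp add: F_def bij_is_inj)
  have "additive F"
  proof (unfold additive_def, intro allI)
    fix u w
    obtain u' w' where uw: "u = q u'" "w = q w'" using q(2) by (metis bij_pointE)
    then have "u + w = q (u' + w')" using q(1) by (simp add: additive.add)
    then show "F (u + w) = F u + F w"
      using p by (simp add: Fq uw additive.add)
  qed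
  moreover have "F u \<in> range (\<lambda>a. scale a u)" for u
  proof -
    obtain v where v: "u = q v" using q(2) by (metis bij_pointE)
    have "p v \<in> p ` range (\<lambda>a. scale a v)" using in_line by blast
    also have "\<dots> = q ` range (\<lambda>a. scale a v)" by (rule same) (rule submodule_line)
    finally show ?thesis using q_line[of v] by (auto simp: v Fq)
  qed
  ultimately obtain a where "\<And>u. F u = scale a u"
    using line_preserving_imp_homothety xy by metis
  then show ?thesis by (metis Fq)
qed

end


section \<open>From lattice actions to representations\<close>

context G_lattice
begin

lemma act_inv_cancel: "\<lbrakk>g \<in> carrier G; m \<in> carrier L\<rbrakk> \<Longrightarrow> act g (act (inv\<^bsub>G\<^esub> g) m) = m"
  and inv_act_cancel: "\<lbrakk>g \<in> carrier G; m \<in> carrier L\<rbrakk> \<Longrightarrow> act (inv\<^bsub>G\<^esub> g) (act g m) = m"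
  by (simp_all add: act_act act_one)

end

lemma bij_of_lattice_action:
  assumes "left_module scale" and L: "G_lattice G (submodule_lattice scale) act"
    and g: "g \<in> carrier G" and f: "semilinear scale f"
    and act: "\<And>W. submodule scale W \<Longrightarrow> act g W = f ` W"
  shows "bij f"
proof -
  interpret left_module scale by fact
  interpret G_lattice G "submodule_lattice scale" act by fact
  have f_zero: "f 0 = 0" by (rule semilinear_zero[OF f])
  \<comment> \<open>If \<open>f\<close> kills \<open>v\<close>, it maps the line of \<open>v\<close> to zero as it does the zero submodule.\<close>
  have kernel: "v = 0" if "f v = 0" for v
  proof -
    let ?W = "range (\<lambda>a. scale a v)"
    have "f (scale a v) = 0" for a
      using f that by (auto simp: semilinear_def scale_zero_right)
    then have "act g ?W = act g {0}"
      by (auto simp: act submodule_line submodule_zero f_zero image_image)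
    then have "?W = {0}"
      using inv_act_cancel[OF g] submodule_line submodule_zero
      by (metis carrier_submodule_lattice)
    then show ?thesis using in_line[of v] by auto
  qed
  have "inj f"
  proof (rule injI)
    fix x y assume "f x = f y"
    then have "f (x - y) = 0" using f by (simp add: semilinear_def additive.diff)
    then show "x = y" using kernel by force
  qed
  moreover have "surj f"
  proof -
    let ?W = "act (inv\<^bsub>G\<^esub> g) UNIV"
    have W: "submodule scale ?W"
      using act_closed[of "inv\<^bsub>G\<^esub> g" UNIV] g by (simp add: submodule_UNIV)
    have "f ` ?W = UNIV"
      using act_inv_cancel[OF g, of UNIV] by (simp add: act[OF W] submodule_UNIV)
    then show ?thesis by blast
  qed
  ultimately show ?thesis by (simp add: bij_def)
qed

lemma coordinatizable_G_lattice_imp_representation: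
  fixes G (structure)
  assumes G: "G_lattice_over G scale act"
    and coord: "\<And>g. g \<in> carrier G \<Longrightarrow> coordinatizable scale (act g)"
  shows "\<exists>\<rho>. semilinear_representation G scale \<rho> \<and>
           (\<forall>g\<in>carrier G. \<forall>W\<in>carrier (submodule_lattice scale). act g W = \<rho> g ` W)"
proof -
  interpret left_module scale using G by (simp add: G_lattice_over_def)
  have L: "G_lattice G (submodule_lattice scale) act" using G by (simp add: G_lattice_over_def)
  interpret G_lattice G "submodule_lattice scale" act by (rule L)
  obtain x y where xy: "independent_pair x y"
    using rank_ge_3_imp_independent_pair G by (auto simp: G_lattice_over_def)
  \<comment> \<open>The lattice map determines \<open>\<rho> g\<close> only up to a scalar, whence a projective representation.\<close>
  have "\<forall>g\<in>carrier G. \<exists>f. semilinear scale f \<and> (\<forall>W. submodule scale W \<longrightarrow> act g W = f ` W)"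
    using coord by (simp add: coordinatizable_def Ball_def)
  then obtain \<rho> where semi: "\<And>g. g \<in> carrier G \<Longrightarrow> semilinear scale (\<rho> g)"
    and act: "\<And>g W. \<lbrakk>g \<in> carrier G; submodule scale W\<rbrakk> \<Longrightarrow> act g W = \<rho> g ` W"
    by metis
  have bij: "bij (\<rho> g)" if "g \<in> carrier G" for g
    using bij_of_lattice_action[OF left_module_axioms L that semi[OF that] act[OF that]] .
  have "\<exists>a. a \<noteq> 0 \<and> \<rho> g \<circ> \<rho> h = (\<lambda>v. scale a (\<rho> (g \<otimes> h) v))"
    if gh: "g \<in> carrier G" "h \<in> carrier G" for g h
  proof -
    have k: "g \<otimes> h \<in> carrier G" using gh by simp
    have "\<exists>a. \<forall>v. (\<rho> g \<circ> \<rho> h) v = scale a (\<rho> (g \<otimes> h) v)"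
    proof (rule same_images_imp_proportional[OF _ _ bij[OF k] _ _ xy])
      show "additive (\<rho> g \<circ> \<rho> h)" "additive (\<rho> (g \<otimes> h))"
        using semi[OF gh(1)] semi[OF gh(2)] semi[OF k] by (auto simp: semilinear_def additive_def)
      show "(\<rho> g \<circ> \<rho> h) ` W = \<rho> (g \<otimes> h) ` W" if W: "submodule scale W" for W
        using act_act[OF gh, of W] W gh k
        by (simp add: act submodule_semilinear_image semi image_comp)
      show "\<rho> (g \<otimes> h) ` range (\<lambda>a. scale a v) \<subseteq> range (\<lambda>a. scale a (\<rho> (g \<otimes> h) v))" for v
        using semi[OF k] by (auto simp: semilinear_def)
    qed
    then obtain a where a: "\<And>v. \<rho> g (\<rho> h v) = scale a (\<rho> (g \<otimes> h) v)" by auto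
    have "a \<noteq> 0"
    proof
      assume "a = 0"
      then have "\<rho> g (\<rho> h x) = \<rho> g (\<rho> h 0)" by (simp add: a scale_zero_left)
      then have "x = 0" using bij[OF gh(1)] bij[OF gh(2)] by (simp add: bij_is_inj inj_eq)
      then show False using xy by (simp add: independent_pair_def)
    qed
    then show ?thesis using a by (auto simp: fun_eq_iff)
  qed
  then have "semilinear_representation G scale \<rho>"
    using semi bij by (auto simp: semilinear_representation_def SGL_def)
  then show ?thesis using act by auto
qed

theorem theorem2:
  fixes G :: "('g, 'm) monoid_scheme"
    and scale :: "'k::division_ring \<Rightarrow> 'v::ab_group_add \<Rightarrow> 'v"
  assumes "group G" and "left_module scale" and "rank scale \<ge> 3"
  shows "(\<forall>\<rho>. semilinear_representation G scale \<rho> \<longrightarrow>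
            G_lattice_over G scale (\<lambda>g W. \<rho> g ` W)) \<and>
         (\<forall>act. G_lattice_over G scale act \<and> (\<forall>g\<in>carrier G. coordinatizable scale (act g)) \<longrightarrow>
            (\<exists>\<rho>. semilinear_representation G scale \<rho> \<and>
                 (\<forall>g\<in>carrier G. \<forall>W\<in>carrier (submodule_lattice scale). act g W = \<rho> g ` W)))"
proof (intro conjI allI impI)
  fix \<rho> assume "semilinear_representation G scale \<rho>"
  then show "G_lattice_over G scale (\<lambda>g W. \<rho> g ` W)"
    by (rule semilinear_representation_imp_G_lattice_over[OF assms])
next
  fix act assume "G_lattice_over G scale act \<and> (\<forall>g\<in>carrier G. coordinatizable scale (act g))"
  then show "\<exists>\<rho>. semilinear_representation G scale \<rho> \<and>
      (\<forall>g\<in>carrier G. \<forall>W\<in>carrier (submodule_lattice scale). act g W = \<rho> g ` W)"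
    by (intro coordinatizable_G_lattice_imp_representation) auto
qed

end
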